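(* Let $m \ge 1$ and let $Z=\langle z_1, z_2, \ldots, z_{2m} \rangle$ be a Half-delete Nim position with $2m$ heaps, where $z_1 \le z_2 \le \cdots \le z_{2m}$ are positive integers. Let $2^s$ be the smallest power of $2$ strictly greater than $z_{m+1}$. Then $Z$ is a $\mathcal{P}$-position if and only if both of the following hold: (a) all of $z_1, z_2, \ldots, z_{m+1}$ are odd; (b) for every $l \in \{1,\ldots,2m\}$, if $z_l$ is even then $2^s \le z_l$.
   Context: Half-delete Nim with $n=2m$ heaps: a position is a $2m$-tuple of positive integers (heap sizes). Two players alternate moves. A move consists of selecting $m$ heaps and deleting them, and then splitting each of the remaining $m$ heaps into two heaps, each containing at least one token (so the number of heaps stays $2m$). Normal play convention: a player who cannot move loses. A $\mathcal{P}$-position is a position from which the player about to move has no winning strategy. *)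

theory Defs
  imports "HOL-Library.Multiset"
begin

text \<open>
  The order of the heaps plays no role in the rules, so a tuple of heap sizes is
  represented by the multiset of its entries.
\<close>

definition hd_position :: "nat \<Rightarrow> nat multiset \<Rightarrow> bool" where
  "hd_position m Z \<longleftrightarrow> size Z = 2 * m \<and> (\<forall>x \<in># Z. 1 \<le> x)"

text \<open>
  \<open>D\<close> consists of the deleted heaps, and \<open>S\<close> lists for each remaining heap the pair of
  heaps into which it is split.
\<close>

definition hd_move :: "nat \<Rightarrow> nat multiset \<Rightarrow> nat multiset \<Rightarrow> bool" where
  "hd_move m Z Z' \<longleftrightarrow>
     (\<exists>(D :: nat multiset) (S :: (nat \<times> nat) multiset).
        size D = m \<and> size S = m \<and>
        (\<forall>(a, b) \<in># S. 1 \<le> a \<and> 1 \<le> b) \<and>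
        Z = D + image_mset (\<lambda>(a, b). a + b) S \<and>
        Z' = image_mset fst S + image_mset snd S)"

text \<open>
  The player about to move at \<open>p\<close> can force a win under normal play: some move leads to a
  \<open>q\<close> such that every reply of the opponent is again winning for the player. In particular
  this holds if the opponent cannot move at \<open>q\<close>.
\<close>

inductive has_winning_strategy :: "('p \<Rightarrow> 'p \<Rightarrow> bool) \<Rightarrow> 'p \<Rightarrow> bool" for mv where
  "mv p q \<Longrightarrow> (\<And>r. mv q r \<Longrightarrow> has_winning_strategy mv r) \<Longrightarrow> has_winning_strategy mv p"

definition hd_P_position :: "nat \<Rightarrow> nat multiset \<Rightarrow> bool" where
  "hd_P_position m Z \<longleftrightarrow> hd_position m Z \<and> \<not> has_winning_strategy (hd_move m) Z"

lemma hd_move_position: "hd_move m Z Z' \<Longrightarrow> hd_position m Z'"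
  unfolding hd_move_def hd_position_def by fastforce

end

theory Submission
  imports Defs
begin

text \<open>
  A position is a P-position iff for some \<open>k\<close> more than \<open>m\<close> heaps are smaller than \<open>2^k\<close>
  and all heaps smaller than \<open>2^k\<close> are odd.

  From such a position every move splits some odd heap below \<open>2^k\<close>, creating an even heap below
  \<open>2^k\<close>. If the result were again of this kind, with witness \<open>k'\<close>, then \<open>k' < k\<close>, and by the
  pigeonhole principle some heap was split into two odd heaps below \<open>2^k'\<close>; it was thus an even
  heap below \<open>2^k\<close>, which is impossible.

  Otherwise let \<open>e\<close> be the smallest even heap and \<open>2^k \<le> e < 2^(k+1)\<close>. At most \<open>m\<close> heaps are
  below \<open>2^k\<close>, so one can keep \<open>m\<close> heaps of size at least \<open>2^k\<close>, including \<open>e\<close>. Splitting \<open>e\<close>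
  into two odd heaps below \<open>2^k\<close>, and every other kept heap \<open>x\<close> into \<open>1\<close> and \<open>x - 1\<close>,
  reaches a position of the above kind.
\<close>

text \<open>Leaving \<open>k\<close> free avoids sorting the heaps; for sorted heaps
  \<open>s\<close> turns out to be the only exponent worth testing.\<close>

definition odd_below_power :: "nat \<Rightarrow> nat \<Rightarrow> nat multiset \<Rightarrow> bool" where
  "odd_below_power m k Z \<longleftrightarrow>
     m < size (filter_mset (\<lambda>x. x < 2 ^ k) Z) \<and> (\<forall>x \<in># Z. x < 2 ^ k \<longrightarrow> odd x)"

text \<open>A pair whose components do not both satisfy \<open>P\<close> adds at most one to the two
  counts together.\<close>

lemma pigeonhole_pairs_mset:
  assumes "size S < size (filter_mset P (image_mset fst S)) + size (filter_mset P (image_mset snd S))"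
  shows "\<exists>(a, b) \<in># S. P a \<and> P b"
  using assms by (induction S) (auto split: if_splits)

lemma obtain_submset_size:
  assumes "n \<le> size M"
  obtains K where "K \<subseteq># M" "size K = n"
proof -
  obtain xs where "M = mset xs"
    by (metis ex_mset)
  with assms have "mset (take n xs) \<subseteq># M" "size (mset (take n xs)) = n"
    by (auto simp: mset_subset_eq_exists_conv) (metis append_take_drop_id mset_append)
  then show thesis by (rule that)
qed

lemma no_move_between_odd_below_power:
  assumes move: "hd_move m Z Z'" and Z: "odd_below_power m k Z"
  shows "\<not> odd_below_power m k' Z'"
proof
  assume Z': "odd_below_power m k' Z'"
  obtain D S where sizes: "size D = m" "size S = m"
    and Z_eq: "Z = D + image_mset (\<lambda>(a, b). a + b) S"
    and Z'_eq: "Z' = image_mset fst S + image_mset snd S"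
    using move unfolding hd_move_def by blast
  have sum_odd: "odd (a + b)" if "(a, b) \<in># S" "a + b < 2 ^ k" for a b
    using Z that unfolding odd_below_power_def Z_eq by fastforce
  have part_odd: "odd a \<and> odd b" if "(a, b) \<in># S" "a < 2 ^ k'" "b < 2 ^ k'" for a b
    using Z' that unfolding odd_below_power_def Z'_eq by force
  \<comment> \<open>More than \<open>m\<close> heaps are below \<open>2 ^ k\<close> and only
    \<open>m\<close> are deleted, so one of them must be split.\<close>
  have "size (filter_mset (\<lambda>x. x < 2 ^ k) D) \<le> m"
    using size_filter_mset_lesseq sizes(1) by metis
  then have "0 < size (filter_mset (\<lambda>x. x < 2 ^ k) (image_mset (\<lambda>(a, b). a + b) S))"
    using Z unfolding odd_below_power_def Z_eq filter_union_mset size_union by linarith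
  then obtain a b where ab: "(a, b) \<in># S" "a + b < 2 ^ k"
    by (auto simp flip: nonempty_has_size)
  \<comment> \<open>Otherwise both parts of the odd sum \<open>a + b\<close> would be below
    \<open>2 ^ k'\<close>, hence odd.\<close>
  have "k' < k"
  proof (rule ccontr)
    assume "\<not> k' < k"
    then have "(2::nat) ^ k \<le> 2 ^ k'" by simp
    with ab have "a < 2 ^ k'" "b < 2 ^ k'" by linarith+
    then show False using sum_odd part_odd ab by fastforce
  qed
  have "\<exists>(c, d) \<in># S. c < 2 ^ k' \<and> d < 2 ^ k'"
    using Z' sizes unfolding odd_below_power_def Z'_eq by (intro pigeonhole_pairs_mset) simp
  then obtain c d where cd: "(c, d) \<in># S" "c < 2 ^ k'" "d < 2 ^ k'" by auto
  have "(2::nat) ^ Suc k' \<le> 2 ^ k"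
    using \<open>k' < k\<close> by (intro power_increasing) auto
  with cd have "c + d < 2 ^ k" by simp
  then show False using sum_odd part_odd cd by fastforce
qed

lemma move_to_odd_below_power:
  assumes "1 \<le> m" and pos: "hd_position m Z" and bad: "\<And>k. \<not> odd_below_power m k Z"
  obtains Z' k where "hd_move m Z Z'" "odd_below_power m k Z'"
proof -
  have size_Z: "size Z = 2 * m" and Z_pos: "\<And>x. x \<in># Z \<Longrightarrow> 1 \<le> x"
    using pos unfolding hd_position_def by auto
  have "\<exists>e. e \<in># Z \<and> even e"
  proof (rule ccontr)
    assume no_even: "\<nexists>e. e \<in># Z \<and> even e"
    \<comment> \<open>The total is a crude exponent, large enough to put every heap below the
      power.\<close>
    have "x < 2 ^ sum_mset Z" if "x \<in># Z" for x
    proof -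
      have "x \<le> sum_mset Z" using multi_member_split[OF that] by auto
      then show ?thesis by (rule order_le_less_trans) (rule less_exp)
    qed
    then have "filter_mset (\<lambda>x. x < 2 ^ sum_mset Z) Z = Z"
      by (simp add: filter_mset_eq_conv)
    then have "odd_below_power m (sum_mset Z) Z"
      using no_even size_Z assms(1) unfolding odd_below_power_def by auto
    with bad show False by blast
  qed
  then obtain e where e: "e \<in># Z" "even e" and e_least: "\<And>x. x \<in># Z \<Longrightarrow> even x \<Longrightarrow> e \<le> x"
    using exists_least_iff[of "\<lambda>e. e \<in># Z \<and> even e"] by (metis leI)
  have "1 \<le> e" using Z_pos e by blast
  then obtain k where k: "2 ^ k \<le> e" "e < 2 ^ Suc k"
    using ex_power_ivl1[of 2 e] by auto
  \<comment> \<open>With \<open>k = 0\<close> the even heap \<open>e\<close> would be 1. The splits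
    below need \<open>2 ^ k\<close> to be even.\<close>
  have "k \<noteq> 0" using k e \<open>1 \<le> e\<close> by (cases k) auto
  then have even_pow: "even ((2::nat) ^ k)" and pow_ge: "2 \<le> (2::nat) ^ k"
    by (auto simp: self_le_power)
  define B where "B = filter_mset (\<lambda>x. \<not> x < 2 ^ k) Z"
  \<comment> \<open>Heaps below \<open>2 ^ k\<close> are smaller than \<open>e\<close>, hence odd,
    so only the counting clause can fail.\<close>
  have "size (filter_mset (\<lambda>x. x < 2 ^ k) Z) \<le> m"
    using bad[of k] k e_least unfolding odd_below_power_def by fastforce
  moreover have "size (filter_mset (\<lambda>x. x < 2 ^ k) Z) + size B = 2 * m"
    unfolding B_def size_Z[symmetric] by (metis multiset_partition size_union)
  ultimately have "m \<le> size B" by linarith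
  moreover have "e \<in># B" using e k by (simp add: B_def)
  ultimately have "m - 1 \<le> size (B - {#e#})"
    by (simp add: size_Diff_singleton)
  then obtain K where K: "K \<subseteq># B - {#e#}" "size K = m - 1"
    by (rule obtain_submset_size)
  define L where "L = add_mset e K"
  have "L \<subseteq># B"
    using K \<open>e \<in># B\<close> unfolding L_def by (simp add: insert_subset_eq_iff)
  then have "L \<subseteq># Z" unfolding B_def using multiset_filter_subset subset_mset.trans by blast
  have L_ge: "2 ^ k \<le> x" if "x \<in># L" for x
    using \<open>L \<subseteq># B\<close> that unfolding B_def by (auto dest: mset_subset_eqD)
  have size_L: "size L = m" using K assms(1) unfolding L_def by simp
  \<comment> \<open>As \<open>e\<close> and \<open>2 ^ k\<close> are even, both parts of
    \<open>e\<close> are odd; \<open>2 ^ k - 1\<close> is the largest part allowed, which makes the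
    other as small as possible.\<close>
  define f :: "nat \<Rightarrow> nat \<times> nat" where
    "f x = (if x = e then (2 ^ k - 1, e + 1 - 2 ^ k) else (1, x - 1))" for x
  have fst_f: "odd (fst (f x))" "fst (f x) < 2 ^ k" for x
    using even_pow pow_ge by (auto simp: f_def)
  have snd_f_e: "snd (f e) < 2 ^ k" "odd (snd (f e))"
  proof -
    \<comment> \<open>Parity sharpens \<open>e + 1 \<le> 2 ^ Suc k\<close> to a strict
      inequality.\<close>
    have "odd (e + 1)" "even ((2::nat) ^ Suc k)" using e(2) by auto
    then have "e + 1 \<noteq> 2 ^ Suc k" by metis
    then show "snd (f e) < 2 ^ k" using k pow_ge by (auto simp: f_def)
    show "odd (snd (f e))" using e(2) k even_pow by (simp add: f_def)
  qed
  have snd_f: "odd (snd (f x))" if "x \<in># L" "snd (f x) < 2 ^ k" for x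
  proof (cases "x = e")
    case False
    \<comment> \<open>The part \<open>x - 1\<close> can drop below \<open>2 ^ k\<close> only for
      \<open>x = 2 ^ k\<close>, and then it is odd.\<close>
    then have "x \<le> 2 ^ k" using that pow_ge by (simp add: f_def)
    with L_ge that have "x = 2 ^ k" by (simp add: order_antisym)
    then show ?thesis using False even_pow pow_ge by (simp add: f_def)
  qed (use snd_f_e in simp)
  have sum_f: "fst (f x) + snd (f x) = x" if "x \<in># L" for x
    using L_ge[OF that] pow_ge k by (auto simp: f_def)
  have f_pos: "1 \<le> fst (f x)" "1 \<le> snd (f x)" if "x \<in># L" for x
    using L_ge[OF that] pow_ge k by (auto simp: f_def)
  define S where "S = image_mset f L"
  define Z' where "Z' = image_mset fst S + image_mset snd S"
  have "image_mset (\<lambda>(a, b). a + b) S = L"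
    unfolding S_def multiset.map_comp comp_def using sum_f
    by (simp add: case_prod_beta cong: image_mset_cong)
  then have "hd_move m Z Z'"
    unfolding hd_move_def
    using \<open>L \<subseteq># Z\<close> size_L size_Z f_pos
    by (intro exI[of _ "Z - L"] exI[of _ S])
      (auto simp: Z'_def S_def size_Diff_submset case_prod_beta)
  moreover have "odd_below_power m k Z'"
    unfolding odd_below_power_def
  proof
    \<comment> \<open>The first components supply \<open>m\<close> small heaps; the second part of
      \<open>e\<close> is the one more that is required.\<close>
    have "filter_mset (\<lambda>x. x < 2 ^ k) (image_mset fst S) = image_mset fst S"
      using fst_f by (auto simp: filter_mset_eq_conv S_def)
    moreover have "size (filter_mset (\<lambda>x. x < 2 ^ k) (image_mset snd S)) > 0"
      using snd_f_e by (simp add: S_def L_def)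
    ultimately show "m < size (filter_mset (\<lambda>x. x < 2 ^ k) Z')"
      using size_L by (simp add: Z'_def S_def)
    show "\<forall>x \<in># Z'. x < 2 ^ k \<longrightarrow> odd x"
      using fst_f snd_f by (auto simp: Z'_def S_def)
  qed
  ultimately show thesis by (rule that)
qed

text \<open>Splitting preserves the number of tokens and deletion removes some, which gives a
  measure for induction on positions.\<close>

lemma sum_mset_hd_move_less:
  assumes "1 \<le> m" "hd_position m Z" "hd_move m Z Z'"
  shows "sum_mset Z' < sum_mset Z"
proof -
  obtain D S where "size D = m"
    and Z: "Z = D + image_mset (\<lambda>(a, b). a + b) S"
    and Z': "Z' = image_mset fst S + image_mset snd S"
    using assms(3) unfolding hd_move_def by blast
  then obtain x where "x \<in># D"
    using assms(1) by (metis One_nat_def multiset_nonemptyE not_one_le_zero size_empty)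
  then have "0 < sum_mset D"
    using assms(2) unfolding hd_position_def Z by force
  moreover have "sum_mset Z = sum_mset D + sum_mset Z'"
    unfolding Z Z' by (simp add: case_prod_unfold sum_mset.distrib)
  ultimately show ?thesis by simp
qed

text \<open>Rule induction on the strategy shows that no \<open>odd_below_power\<close> position is
  winning, since every move from it can be answered by a return to the class. Conversely, moving
  into the class wins by induction on the number of tokens.\<close>

lemma hd_P_position_iff_odd_below_power:
  assumes "1 \<le> m" "hd_position m Z"
  shows "hd_P_position m Z \<longleftrightarrow> (\<exists>k. odd_below_power m k Z)"
proof -
  have not_winning: "\<forall>k. \<not> odd_below_power m k p" if "has_winning_strategy (hd_move m) p" for p
    using that
  proof induction
    case (1 p q)
    show ?case
    proof (intro allI notI)
      fix k assume "odd_below_power m k p"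
      then have "\<not> odd_below_power m k' q" for k'
        using no_move_between_odd_below_power 1 by blast
      then obtain r k' where "hd_move m q r" "odd_below_power m k' r"
        using move_to_odd_below_power assms(1) hd_move_position 1(1) by metis
      then show False using 1 by blast
    qed
  qed
  have winning: "has_winning_strategy (hd_move m) p"
    if "hd_position m p" "\<forall>k. \<not> odd_below_power m k p" for p
    using that
  proof (induction "sum_mset p" arbitrary: p rule: less_induct)
    case less
    then obtain q k where q: "hd_move m p q" "odd_below_power m k q"
      using move_to_odd_below_power[OF assms(1)] by metis
    show ?case
    proof (rule has_winning_strategy.intros[of "hd_move m", OF q(1)])
      fix r assume r: "hd_move m q r"
      have "sum_mset r < sum_mset p"
        using sum_mset_hd_move_less[OF assms(1)] less.prems(1) q(1) r hd_move_position
        by (meson less_trans)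
      then show "has_winning_strategy (hd_move m) r"
        using less.hyps no_move_between_odd_below_power[OF r q(2)] hd_move_position[OF r] by blast
    qed
  qed
  show ?thesis
    using assms(2) not_winning winning unfolding hd_P_position_def by blast
qed

theorem theorem5p2:
  fixes m s :: nat and z :: "nat \<Rightarrow> nat"
  assumes "m \<ge> 1"
    and "\<forall>i \<in> {1..2*m}. z i \<ge> 1"
    and "\<forall>i \<in> {1..2*m}. \<forall>j \<in> {1..2*m}. i \<le> j \<longrightarrow> z i \<le> z j"
    and "s = (LEAST k. z (m + 1) < 2 ^ k)"
  shows "hd_P_position m (image_mset z (mset_set {1..2*m})) \<longleftrightarrow>
           (\<forall>l \<in> {1..m+1}. odd (z l)) \<and>
           (\<forall>l \<in> {1..2*m}. even (z l) \<longrightarrow> 2 ^ s \<le> z l)"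
proof -
  let ?Z = "image_mset z (mset_set {1..2*m})"
  have "hd_position m ?Z"
    using assms(2) by (simp add: hd_position_def)
  then have P_iff: "hd_P_position m ?Z \<longleftrightarrow> (\<exists>k. odd_below_power m k ?Z)"
    using assms(1) hd_P_position_iff_odd_below_power by blast
  have size_eq: "size (filter_mset (\<lambda>x. x < 2 ^ k) ?Z) = card {l \<in> {1..2*m}. z l < 2 ^ k}" for k
    by (simp add: filter_mset_image_mset)
  \<comment> \<open>By sortedness \<open>z (m + 1)\<close> is the \<open>m + 1\<close>-st smallest
    heap, so it decides whether more than \<open>m\<close> heaps lie below a bound.\<close>
  have many_below_iff: "m < size (filter_mset (\<lambda>x. x < 2 ^ k) ?Z) \<longleftrightarrow> z (m + 1) < 2 ^ k" for k
  proof
    assume "z (m + 1) < 2 ^ k"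
    moreover have "z l \<le> z (m + 1)" if "l \<in> {1..m+1}" for l
      using assms(1,3) that by auto
    ultimately have "z l < 2 ^ k" if "l \<in> {1..m+1}" for l
      using that order_le_less_trans by blast
    then have "{1..m+1} \<subseteq> {l \<in> {1..2*m}. z l < 2 ^ k}"
      using assms(1) by auto
    then have "card {1..m+1} \<le> card {l \<in> {1..2*m}. z l < 2 ^ k}"
      by (intro card_mono) auto
    then show "m < size (filter_mset (\<lambda>x. x < 2 ^ k) ?Z)"
      unfolding size_eq by simp
  next
    assume many: "m < size (filter_mset (\<lambda>x. x < 2 ^ k) ?Z)"
    show "z (m + 1) < 2 ^ k"
    proof (rule ccontr)
      assume large: "\<not> z (m + 1) < 2 ^ k"
      have "\<not> z l < 2 ^ k" if "l \<in> {m+1..2*m}" for l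
      proof -
        have "z (m + 1) \<le> z l" using assms(1,3) that by auto
        with large show ?thesis by linarith
      qed
      then have "{l \<in> {1..2*m}. z l < 2 ^ k} \<subseteq> {1..m}"
        by (auto simp: not_less_eq_eq intro: ccontr)
      then have "card {l \<in> {1..2*m}. z l < 2 ^ k} \<le> card {1..m}"
        by (intro card_mono) auto
      with many show False unfolding size_eq by simp
    qed
  qed
  have s_bound: "z (m + 1) < 2 ^ s"
    unfolding assms(4) by (rule LeastI[of _ "z (m + 1)"]) (rule less_exp)
  have s_least: "s \<le> k" if "z (m + 1) < 2 ^ k" for k
    unfolding assms(4) using that by (rule Least_le)
  have odd_iff: "odd_below_power m k ?Z \<longleftrightarrow>
      z (m + 1) < 2 ^ k \<and> (\<forall>l \<in> {1..2*m}. even (z l) \<longrightarrow> 2 ^ k \<le> z l)" for k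
    unfolding odd_below_power_def many_below_iff by (auto simp: not_le)
  \<comment> \<open>The bound on even heaps weakens as \<open>k\<close> decreases, and
    \<open>s\<close> is the least exponent satisfying the other clause.\<close>
  have "(\<exists>k. odd_below_power m k ?Z) \<longleftrightarrow> odd_below_power m s ?Z"
  proof
    assume "\<exists>k. odd_below_power m k ?Z"
    then obtain k where k: "odd_below_power m k ?Z" by blast
    then have "(2::nat) ^ s \<le> 2 ^ k" using s_least odd_iff by simp
    then show "odd_below_power m s ?Z"
      using k s_bound unfolding odd_iff by (meson order_trans)
  qed blast
  also have "\<dots> \<longleftrightarrow> (\<forall>l \<in> {1..m+1}. odd (z l)) \<and>
      (\<forall>l \<in> {1..2*m}. even (z l) \<longrightarrow> 2 ^ s \<le> z l)"
  proof -
    \<comment> \<open>Heaps up to index \<open>m + 1\<close> lie below \<open>2 ^ s\<close>, so the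
      bound on even heaps forces them to be odd.\<close>
    have "z l < 2 ^ s" if "l \<in> {1..m+1}" for l
    proof -
      have "z l \<le> z (m + 1)" using assms(1,3) that by auto
      with s_bound show ?thesis by linarith
    qed
    moreover have "l \<in> {1..2*m}" if "l \<in> {1..m+1}" for l
      using assms(1) that by auto
    ultimately show ?thesis
      unfolding odd_iff using s_bound by (meson not_le)
  qed
  finally show ?thesis using P_iff by simp
qed

end
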